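(* There exists a constant $c>0$ such that for all sufficiently large integers $d$ (in particular for all $d>3$, after adjusting $c$), $N_d > c\,\frac{d}{\sqrt{\log d}}$.
   Context: A lattice $\Lambda\subset\mathbb{R}^d$ is \emph{well-rounded} if its shortest nonzero vectors (with respect to the Euclidean norm) span $\mathbb{R}^d$, and \emph{unimodular} if its covolume equals $1$. The \emph{covering radius} $r(\Lambda)$ of a lattice $\Lambda\subset\mathbb{R}^d$ is the least $r\ge 0$ such that $\mathbb{R}^d=\Lambda+B_r$, where $B_r$ is the closed Euclidean ball of radius $r$ centered at $0$. $N_d$ denotes the supremum of $r(\Lambda)$ over all well-rounded unimodular lattices $\Lambda\subset\mathbb{R}^d$. *)

theory Defs
  imports Complex_Main "HOL-Library.Extended_Real" "Jordan_Normal_Form.Determinant"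
begin

definition lattice_of :: "real mat \<Rightarrow> real vec set" where
  "lattice_of B = {B *\<^sub>v map_vec real_of_int z | z. z \<in> carrier_vec (dim_col B)}"

definition is_lattice :: "nat \<Rightarrow> real vec set \<Rightarrow> bool" where
  "is_lattice d L \<longleftrightarrow> (\<exists>B \<in> carrier_mat d d. det B \<noteq> 0 \<and> L = lattice_of B)"

definition unimodular :: "nat \<Rightarrow> real vec set \<Rightarrow> bool" where
  "unimodular d L \<longleftrightarrow> (\<exists>B \<in> carrier_mat d d. \<bar>det B\<bar> = 1 \<and> L = lattice_of B)"

definition vnorm :: "real vec \<Rightarrow> real" where
  "vnorm v = sqrt (scalar_prod v v)"

definition shortest_vectors :: "real vec set \<Rightarrow> real vec set" where
  "shortest_vectors L = {v \<in> L. v \<noteq> 0\<^sub>v (dim_vec v) \<and>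
      (\<forall>w \<in> L. w \<noteq> 0\<^sub>v (dim_vec w) \<longrightarrow> vnorm v \<le> vnorm w)}"

definition spans :: "nat \<Rightarrow> real vec set \<Rightarrow> bool" where
  "spans d S \<longleftrightarrow> (\<forall>x \<in> carrier_vec d. \<exists>vs c. set vs \<subseteq> S \<and>
      c \<in> carrier_vec (length vs) \<and> x = mat_of_cols d vs *\<^sub>v c)"

definition well_rounded :: "nat \<Rightarrow> real vec set \<Rightarrow> bool" where
  "well_rounded d L \<longleftrightarrow> spans d (shortest_vectors L)"

definition covering_radius :: "nat \<Rightarrow> real vec set \<Rightarrow> real" where
  "covering_radius d L = Inf {r. r \<ge> 0 \<and> (\<forall>x \<in> carrier_vec d. \<exists>v \<in> L. vnorm (x - v) \<le> r)}"

text \<open>N_d, taken in the extended reals so that the supremum is always defined.\<close>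
definition N :: "nat \<Rightarrow> ereal" where
  "N d = (SUP L \<in> {L. is_lattice d L \<and> well_rounded d L \<and> unimodular d L}.
            ereal (covering_radius d L))"

end

theory Submission
  imports Defs
begin

text \<open>
  With \<open>q = 2\<^sup>j\<close> of order \<open>\<surd>d\<close> and \<open>k\<close> of order \<open>d / ln d\<close>, consider the lattices between
  \<open>q\<int>\<^sup>d\<close> and \<open>\<int>\<^sup>d\<close> in which the first \<open>k\<close> coordinates are divisible by \<open>q\<close> and the next \<open>k\<close>
  coordinates are given, modulo \<open>q\<close>, by a \<open>k\<close>-rowed integer matrix \<open>A\<close> applied to the remaining ones.
  Since \<open>q e\<^sub>i\<close> belongs to the lattice for all \<open>i\<close>, it is well-rounded as soon as it has no nonzero
  vector shorter than \<open>q\<close>. A random \<open>A\<close> achieves this: a short vector is \<open>2\<^sup>i\<close> times a vector of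
  norm at most \<open>2\<^sup>u\<close>, \<open>u = j - i\<close>, having an odd coordinate among the remaining ones; such a
  vector survives with probability \<open>2\<^sup>-\<^sup>u\<^sup>k\<close>, which beats the number of integer points in the ball of
  radius \<open>2\<^sup>u\<close>. The determinant \<open>q\<^sup>2\<^sup>k\<close> is at most exponential in \<open>d\<close>, so normalising costs only a
  constant factor, whereas the point with first \<open>k\<close> coordinates \<open>q/2\<close> and zeros elsewhere has distance at least
  \<open>q \<surd>k / 2\<close> from the lattice, which is of order \<open>d / \<surd>(ln d)\<close>.
\<close>

subsection \<open>Counting integer points and solutions of congruences\<close>

text \<open>Shifting the invertible coordinate by \<open>0, \<dots>, N - 1\<close> produces disjoint copies of the solution set.\<close>

lemma card_congruence_solutions:
  fixes q N :: nat and z :: "'a \<Rightarrow> int" and c :: int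
  assumes "finite J" and l: "l \<in> J" and co: "coprime (z l) (int N)" and dvd: "N dvd q" and "q > 0"
  shows "card {h \<in> PiE J (\<lambda>_. {0..<int q}). int N dvd c - (\<Sum>r\<in>J. h r * z r)} * N
           \<le> card (PiE J (\<lambda>_. {0..<int q}))"
proof -
  let ?R = "PiE J (\<lambda>_. {0..<int q})"
  let ?B = "{h \<in> ?R. int N dvd c - (\<Sum>r\<in>J. h r * z r)}"
  let ?f = "\<lambda>(h, t). h(l := (h l + t) mod int q)"
  have Nq: "int N dvd int q" using dvd by simp
  have fin: "finite ?R" using \<open>finite J\<close> by (intro finite_PiE) auto
  have "inj_on ?f (?B \<times> {0..<int N})"
  proof (rule inj_onI, clarify)
    fix h t h' t'
    assume h: "h \<in> ?R" "int N dvd c - (\<Sum>r\<in>J. h r * z r)" and t: "t \<in> {0..<int N}"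
      and h': "h' \<in> ?R" "int N dvd c - (\<Sum>r\<in>J. h' r * z r)" and t': "t' \<in> {0..<int N}"
      and eq: "h(l := (h l + t) mod int q) = h'(l := (h' l + t') mod int q)"
    have off: "h r = h' r" if "r \<noteq> l" for r using fun_cong[OF eq, of r] that by simp
    have "(h l + t) mod int q = (h' l + t') mod int q" using fun_cong[OF eq, of l] by simp
    then have "int q dvd (h l + t) - (h' l + t')" by (simp add: mod_eq_dvd_iff)
    then have d1: "int N dvd (h l - h' l) + (t - t')" and
      q1: "int q dvd (h l - h' l) + (t - t')" using Nq by (auto simp: algebra_simps intro: dvd_trans)
    have "(\<Sum>r\<in>J. h r * z r) - (\<Sum>r\<in>J. h' r * z r) = (h l - h' l) * z l"
    proof -
      have "(\<Sum>r\<in>J - {l}. h r * z r) = (\<Sum>r\<in>J - {l}. h' r * z r)"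
        by (intro sum.cong) (auto simp: off)
      then show ?thesis using \<open>finite J\<close> l
        by (simp add: sum.remove[of J l] algebra_simps)
    qed
    moreover have "int N dvd (\<Sum>r\<in>J. h r * z r) - (\<Sum>r\<in>J. h' r * z r)"
      using dvd_diff[OF h'(2) h(2)] by simp
    \<comment> \<open>Coprimality cancels \<open>z l\<close>, so \<open>h l\<close> and
      \<open>h' l\<close> agree modulo \<open>N\<close>. Hence \<open>t\<close> and
      \<open>t'\<close> agree modulo \<open>N\<close> and, both lying below \<open>N\<close>,
      coincide; the congruence modulo \<open>q\<close> then gives back \<open>h l\<close>.\<close>
    ultimately have "int N dvd h l - h' l"
      using co by (simp add: coprime_dvd_mult_left_iff coprime_commute)
    then have "int N dvd t - t'" using d1 dvd_add_right_iff by blast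
    then have "t mod int N = t' mod int N" by (simp add: mod_eq_dvd_iff)
    then have tt: "t = t'" using t t' by simp
    with q1 have "h l mod int q = h' l mod int q" by (simp add: mod_eq_dvd_iff)
    moreover have "h l \<in> {0..<int q}" "h' l \<in> {0..<int q}" using h(1) h'(1) l by (auto simp: PiE_iff)
    ultimately have "h l = h' l" by simp
    with off have "h = h'" by (metis ext)
    with tt show "h = h' \<and> t = t'" by simp
  qed
  moreover have "?f ` (?B \<times> {0..<int N}) \<subseteq> ?R"
    using l \<open>q > 0\<close> by (auto simp: PiE_iff extensional_def)
  ultimately have "card (?B \<times> {0..<int N}) \<le> card ?R" using fin by (rule card_inj_on_le)
  then show ?thesis by (simp add: card_cartesian_product)
qed

section \<open>Integer points in a ball\<close>

lemma sum_power_square_le: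
  fixes w :: real
  assumes "0 < w" "w \<le> 1/2"
  shows "(\<Sum>a\<in>{- int M..int M}. w ^ nat (a\<^sup>2)) \<le> 1 + 4 * w"
proof -
  \<comment> \<open>The subtracted tail makes the induction close: the two new terms are at most
    \<open>2 * w ^ Suc M\<close>, and for \<open>w\<close> at most 1/2 the tail shrinks by at least
    that much.\<close>
  have "(\<Sum>a\<in>{- int M..int M}. w ^ nat (a\<^sup>2)) \<le> 1 + 4 * w - 4 * w ^ Suc M"
  proof (induction M)
    case 0
    then show ?case by simp
  next
    case (Suc M)
    have sq: "w ^ nat ((1 + int M)\<^sup>2) \<le> w ^ Suc M"
    proof (rule power_decreasing)
      have "int (Suc M) * 1 \<le> int (Suc M) * int (Suc M)" by (intro mult_left_mono) auto
      then show "Suc M \<le> nat ((1 + int M)\<^sup>2)" by (simp add: power2_eq_square le_nat_iff)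
    qed (use assms in auto)
    have "{- int (Suc M)..int (Suc M)} = insert (- (1 + int M)) (insert (1 + int M) {- int M..int M})"
      by auto
    moreover have "(- 1 - int M)\<^sup>2 = (1 + int M)\<^sup>2" by (simp add: power2_eq_square algebra_simps)
    ultimately have "(\<Sum>a\<in>{- int (Suc M)..int (Suc M)}. w ^ nat (a\<^sup>2))
        = 2 * w ^ nat ((1 + int M)\<^sup>2) + (\<Sum>a\<in>{- int M..int M}. w ^ nat (a\<^sup>2))"
      by simp
    also have "\<dots> \<le> 2 * w ^ Suc M + (1 + 4 * w - 4 * w ^ Suc M)" using Suc sq by linarith
    also have "\<dots> \<le> 1 + 4 * w - 4 * w ^ Suc (Suc M)"
      using assms mult_right_mono[of w "1/2" "w ^ Suc M"] by simp
    finally show ?case .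
  qed
  also have "\<dots> \<le> 1 + 4 * w" using assms by simp
  finally show ?thesis .
qed

text \<open>Chernoff bound: each point of the ball has weight \<open>w\<close> to its squared norm, at least \<open>w\<^sup>R\<close>.\<close>

lemma card_integer_points_weighted:
  fixes w :: real
  assumes "finite I" "0 < w" "w \<le> 1/2"
  shows "real (card {x \<in> PiE I (\<lambda>_. {- int M..int M}). (\<Sum>i\<in>I. (x i)\<^sup>2) \<le> int R}) * w ^ R
           \<le> (1 + 4 * w) ^ card I"
proof -
  let ?P = "PiE I (\<lambda>_. {- int M..int M})"
  let ?S = "{x \<in> ?P. (\<Sum>i\<in>I. (x i)\<^sup>2) \<le> int R}"
  have fin: "finite ?P" using assms by (intro finite_PiE) auto
  have "real (card ?S) * w ^ R = (\<Sum>x\<in>?S. w ^ R)" by simp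
  also have "\<dots> \<le> (\<Sum>x\<in>?S. \<Prod>i\<in>I. w ^ nat ((x i)\<^sup>2))"
  proof (rule sum_mono)
    fix x assume x: "x \<in> ?S"
    have "int (\<Sum>i\<in>I. nat ((x i)\<^sup>2)) = (\<Sum>i\<in>I. (x i)\<^sup>2)" by simp
    then have "(\<Sum>i\<in>I. nat ((x i)\<^sup>2)) \<le> R" using x by (auto simp del: of_nat_sum)
    then have "w ^ R \<le> w ^ (\<Sum>i\<in>I. nat ((x i)\<^sup>2))" using assms by (intro power_decreasing) auto
    then show "w ^ R \<le> (\<Prod>i\<in>I. w ^ nat ((x i)\<^sup>2))" by (simp add: power_sum)
  qed
  \<comment> \<open>Over the full box the sum factors into one-dimensional sums.\<close>
  also have "\<dots> \<le> (\<Sum>x\<in>?P. \<Prod>i\<in>I. w ^ nat ((x i)\<^sup>2))"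
    using fin assms by (intro sum_mono2) (auto intro!: prod_nonneg)
  also have "\<dots> = (\<Prod>i\<in>I. \<Sum>a\<in>{- int M..int M}. w ^ nat (a\<^sup>2))"
    using assms by (subst prod_sum_PiE) auto
  also have "\<dots> \<le> (\<Prod>i\<in>I. 1 + 4 * w)"
    using assms sum_power_square_le[of w M] by (intro prod_mono) (auto intro!: sum_nonneg)
  finally show ?thesis by simp
qed

text \<open>The Chernoff weight \<open>w\<close> is tuned to the dimension:
  \<open>4 * w * 4 ^ Suc (u + t)\<close> equals \<open>4 ^ Suc u\<close>, so the numerator costs
  only exp of a multiple of the squared radius \<open>4 ^ u\<close>. Dividing by
  \<open>w ^ (4 ^ u)\<close> contributes the factor linear in \<open>t\<close>.\<close>

lemma card_integer_points_le:
  assumes "finite I" "card I \<le> 4 ^ Suc (u + t)"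
  shows "card {x \<in> PiE I (\<lambda>_. {- int M..int M}). (\<Sum>i\<in>I. (x i)\<^sup>2) \<le> int (4 ^ u)}
           \<le> 2 ^ (2 * (t + 5) * 4 ^ u)"
proof -
  let ?c = "card {x \<in> PiE I (\<lambda>_. {- int M..int M}). (\<Sum>i\<in>I. (x i)\<^sup>2) \<le> int (4 ^ u)}"
  define w :: real where "w = 1 / 4 ^ Suc t"
  have "(1::real) \<le> 2 * 4 ^ t" using one_le_power[of "4::real" t] by linarith
  then have "w \<le> 1/2" "0 < w" by (simp_all add: w_def field_simps)
  then have "real ?c * w ^ (4 ^ u) \<le> (1 + 4 * w) ^ card I"
    using card_integer_points_weighted[OF assms(1), of w M "4 ^ u"] by blast
  also have "\<dots> \<le> (1 + 4 * w) ^ (4 ^ Suc (u + t))"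
    using assms(2) \<open>0 < w\<close> by (intro power_increasing) auto
  also have "\<dots> \<le> exp (4 * w) ^ (4 ^ Suc (u + t))"
    using \<open>0 < w\<close> by (intro power_mono exp_ge_add_one_self) auto
  also have "\<dots> = exp (4 ^ Suc u)"
    by (subst exp_of_nat_mult[symmetric]) (simp add: w_def power_add)
  also have "\<dots> = exp 1 ^ (4 ^ Suc u)"
    by (subst exp_of_nat_mult[symmetric]) simp
  also have "\<dots> \<le> 4 ^ (4 ^ Suc u)"
    using exp_le by (intro power_mono) auto
  finally have *: "real ?c * w ^ (4 ^ u) \<le> 4 ^ (4 ^ Suc u)" .
  have "real ?c = real ?c * w ^ (4 ^ u) * (4 ^ Suc t) ^ (4 ^ u)"
    by (simp add: w_def power_one_over)
  also have "\<dots> \<le> 4 ^ (4 ^ Suc u) * (4 ^ Suc t) ^ (4 ^ u)"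
    using * by (intro mult_right_mono) auto
  also have "\<dots> = 4 ^ (4 ^ Suc u + Suc t * 4 ^ u)" by (simp only: power_add power_mult)
  also have "4 ^ Suc u + Suc t * 4 ^ u = (t + 5) * 4 ^ u" by (simp add: algebra_simps)
  also have "(4::real) ^ ((t + 5) * 4 ^ u) = (2 ^ 2) ^ ((t + 5) * 4 ^ u)" by simp
  also have "\<dots> = 2 ^ (2 * ((t + 5) * 4 ^ u))" by (simp only: power_mult)
  finally have "real ?c \<le> real (2 ^ (2 * (t + 5) * 4 ^ u))" by (simp only: mult.assoc of_nat_power of_nat_numeral)
  then show ?thesis by (simp only: of_nat_le_iff)
qed

text \<open>The union bound at level \<open>u\<close>, in exponents and with
  \<open>j = u + t\<close>. From \<open>u + t \<le> u * 2 ^ t\<close> the hypothesis yields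
  \<open>u * k \<ge> 11 * 4 ^ u * 2 ^ t\<close>. Absorbing the summand \<open>u\<close> into one
  \<open>4 ^ u\<close> turns \<open>2 * (t + 5)\<close> into \<open>2 * t + 11\<close>, which is at
  most \<open>11 * 2 ^ t\<close>; the constant 11 is what \<open>t = 0\<close> demands.\<close>

lemma level_exponent_le:
  fixes u t k :: nat
  assumes "1 \<le> u" and k: "11 * 4 ^ (u + t) \<le> k * (u + t)"
  shows "2 * (t + 5) * 4 ^ u + u \<le> u * k"
proof -
  have t: "t + 1 \<le> 2 ^ t" by (induction t) auto
  have "u + t \<le> u * (t + 1)" using assms(1) by (cases u) auto
  also have "\<dots> \<le> u * 2 ^ t" using t by (intro mult_left_mono) auto
  finally have "k * (u + t) \<le> k * (u * 2 ^ t)" by (intro mult_left_mono) auto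
  with k have "11 * 4 ^ (u + t) \<le> k * (u * 2 ^ t)" by linarith
  moreover have "(4::nat) ^ t = 2 ^ t * 2 ^ t" by (simp add: power_mult_distrib[symmetric])
  ultimately have "2 ^ t * (11 * 4 ^ u * 2 ^ t) \<le> 2 ^ t * (u * k)"
    by (simp add: power_add algebra_simps)
  then have 1: "11 * 4 ^ u * 2 ^ t \<le> u * k" by simp
  have "u \<le> 4 ^ u" by (intro less_imp_le power_gt_expt) simp
  then have "2 * (t + 5) * 4 ^ u + u \<le> (2 * t + 11) * 4 ^ u" by (simp add: algebra_simps)
  also have "\<dots> \<le> (11 * 2 ^ t) * 4 ^ u" using t by (intro mult_right_mono) auto
  finally show ?thesis using 1 by (simp add: algebra_simps)
qed

subsection \<open>Avoiding short vectors\<close>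

text \<open>First-moment argument over matrices with entries in \<open>{0..<2 ^ j}\<close>. The
  extra factor \<open>2 ^ u\<close> in \<open>count\<close> limits the matrices spoiled at level
  \<open>u\<close> to a share of \<open>1 / 2 ^ u\<close>, so that all levels together spoil less
  than everything.\<close>

lemma exists_avoiding_matrix:
  fixes I J :: "'a set" and j :: nat
  assumes fin: "finite I" "finite J"
    and count: "\<And>u. 1 \<le> u \<Longrightarrow> u \<le> j \<Longrightarrow>
      card {x \<in> PiE (I \<union> J) (\<lambda>_. {- int (2 ^ u)..int (2 ^ u)}). (\<Sum>i\<in>I \<union> J. (x i)\<^sup>2) \<le> int (4 ^ u)} * 2 ^ u
        \<le> 2 ^ (u * card I)"
  shows "\<exists>A. \<forall>u x. 1 \<le> u \<longrightarrow> u \<le> j \<longrightarrow>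
      (\<Sum>i\<in>I \<union> J. (x i)\<^sup>2) \<le> int (4 ^ u) \<longrightarrow> (\<exists>l\<in>J. odd (x l)) \<longrightarrow>
      \<not> (\<forall>i\<in>I. int (2 ^ u) dvd x i - (\<Sum>l\<in>J. A i l * x l))"
proof -
  let ?R = "PiE J (\<lambda>_. {0..<int (2 ^ j)})"
  let ?\<Omega> = "PiE I (\<lambda>_. ?R)"
  define S where "S u = {x \<in> PiE (I \<union> J) (\<lambda>_. {- int (2 ^ u)..int (2 ^ u)}).
      (\<Sum>i\<in>I \<union> J. (x i)\<^sup>2) \<le> int (4 ^ u)}" for u
  define S' where "S' u = {x \<in> S u. \<exists>l\<in>J. odd (x l)}" for u
  define Bad where "Bad u x = PiE I (\<lambda>i. {h \<in> ?R. int (2 ^ u) dvd x i - (\<Sum>l\<in>J. h l * x l)})" for u x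
  have finR: "finite ?R" using fin by (intro finite_PiE) auto
  then have fin\<Omega>: "finite ?\<Omega>" using fin by (intro finite_PiE) auto
  have "card ?R > 0" using finR by (subst card_gt_0_iff) (auto simp: PiE_eq_empty_iff)
  then have pos: "card ?\<Omega> > 0" using fin by (simp add: card_PiE)
  have finS: "finite (S u)" for u
    unfolding S_def using fin
    by (intro finite_subset[OF _ finite_PiE[of "I \<union> J" "\<lambda>_. {- int (2 ^ u)..int (2 ^ u)}"]]) auto
  have Bad_sub: "Bad u x \<subseteq> ?\<Omega>" for u x unfolding Bad_def by (intro PiE_mono) auto
  \<comment> \<open>An odd coordinate is coprime to \<open>2 ^ u\<close>, so each row meets its
    congruence with probability at most \<open>1 / 2 ^ u\<close>; the rows are independent.\<close>
  have card_Bad: "card (Bad u x) * 2 ^ (u * card I) \<le> card ?\<Omega>" if uj: "u \<le> j" and x: "x \<in> S' u" for u x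
  proof -
    obtain l where l: "l \<in> J" "odd (x l)" using x by (auto simp: S'_def)
    let ?B = "\<lambda>i. card {h \<in> ?R. int (2 ^ u) dvd x i - (\<Sum>l\<in>J. h l * x l)}"
    have "?B i * 2 ^ u \<le> card ?R" for i
      using l uj fin by (intro card_congruence_solutions) (auto simp: le_imp_power_dvd)
    then have "(\<Prod>i\<in>I. ?B i * 2 ^ u) \<le> (\<Prod>i\<in>I. card ?R)" by (intro prod_mono) auto
    then show ?thesis
      using fin by (simp add: Bad_def card_PiE prod.distrib power_mult)
  qed
  have level: "card (\<Union>x\<in>S' u. Bad u x) * 2 ^ u \<le> card ?\<Omega>" if "u \<in> {1..j}" for u
  proof -
    have fS': "finite (S' u)" unfolding S'_def using finS by simp
    have "card (\<Union>x\<in>S' u. Bad u x) * 2 ^ u * 2 ^ (u * card I)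
        \<le> (\<Sum>x\<in>S' u. card (Bad u x)) * 2 ^ u * 2 ^ (u * card I)"
      using fS' by (intro mult_right_mono card_UN_le) auto
    also have "\<dots> = (\<Sum>x\<in>S' u. card (Bad u x) * 2 ^ (u * card I)) * 2 ^ u"
      by (simp add: sum_distrib_left sum_distrib_right algebra_simps)
    also have "\<dots> \<le> (\<Sum>x\<in>S' u. card ?\<Omega>) * 2 ^ u"
      using that by (intro mult_right_mono sum_mono card_Bad) auto
    also have "\<dots> = card ?\<Omega> * (card (S' u) * 2 ^ u)" by simp
    also have "\<dots> \<le> card ?\<Omega> * (card (S u) * 2 ^ u)"
      using finS[of u] by (intro mult_left_mono mult_right_mono card_mono) (auto simp: S'_def)
    also have "\<dots> \<le> card ?\<Omega> * 2 ^ (u * card I)"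
      using that count[of u] unfolding S_def by (intro mult_left_mono) auto
    finally show ?thesis by simp
  qed
  let ?U = "\<Union>u\<in>{1..j}. \<Union>x\<in>S' u. Bad u x"
  have "real (card ?U) \<le> (\<Sum>u\<in>{1..j}. real (card (\<Union>x\<in>S' u. Bad u x)))"
    by (subst of_nat_sum[symmetric], subst of_nat_le_iff, rule card_UN_le) simp
  also have "\<dots> \<le> (\<Sum>u\<in>{1..j}. real (card ?\<Omega>) * (1/2) ^ u)"
  proof (rule sum_mono)
    fix u assume "u \<in> {1..j}"
    then have "real (card (\<Union>x\<in>S' u. Bad u x) * 2 ^ u) \<le> real (card ?\<Omega>)"
      using level by (simp only: of_nat_le_iff)
    then show "real (card (\<Union>x\<in>S' u. Bad u x)) \<le> real (card ?\<Omega>) * (1/2) ^ u"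
      by (simp add: field_simps power_one_over)
  qed
  also have "\<dots> = real (card ?\<Omega>) * (1 - (1/2) ^ j)"
  proof -
    have "(\<Sum>u\<in>{1..j}. (1/2) ^ u) = (1 - (1/2) ^ j :: real)" by (induction j) auto
    then show ?thesis by (simp add: sum_distrib_left[symmetric])
  qed
  also have "\<dots> < real (card ?\<Omega>)" using pos by simp
  finally have less: "card ?U < card ?\<Omega>" by simp
  obtain A where A: "A \<in> ?\<Omega>" "A \<notin> ?U"
  proof -
    have "?U \<subseteq> ?\<Omega>" using Bad_sub by (intro UN_least)
    moreover have "?U \<noteq> ?\<Omega>"
    proof
      assume "?U = ?\<Omega>"
      then have "card ?U = card ?\<Omega>" by (rule arg_cong)
      with less show False by (simp only: less_irrefl)
    qed
    ultimately have "\<not> ?\<Omega> \<subseteq> ?U" using subset_antisym by blast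
    then show ?thesis using that by blast
  qed
  show ?thesis
  proof (intro exI[of _ A] allI impI notI)
    fix u x
    assume u: "1 \<le> u" "u \<le> j" and sq: "(\<Sum>i\<in>I \<union> J. (x i)\<^sup>2) \<le> int (4 ^ u)"
      and od: "\<exists>l\<in>J. odd (x l)" and dv: "\<forall>i\<in>I. int (2 ^ u) dvd x i - (\<Sum>l\<in>J. A i l * x l)"
    \<comment> \<open>The counted points are extensional functions, so an arbitrary \<open>x\<close>
      is first cut down to \<open>I \<union> J\<close>; the box condition follows from the norm
      bound.\<close>
    let ?x = "restrict x (I \<union> J)"
    have "x i \<in> {- int (2 ^ u)..int (2 ^ u)}" if "i \<in> I \<union> J" for i
    proof -
      have "(x i)\<^sup>2 \<le> (\<Sum>i\<in>I \<union> J. (x i)\<^sup>2)" using that fin by (intro member_le_sum) auto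
      also have "\<dots> \<le> (int (2 ^ u))\<^sup>2" using sq by (simp add: power2_eq_square power_mult_distrib[symmetric])
      finally have "\<bar>x i\<bar> \<le> \<bar>int (2 ^ u)\<bar>" by (simp only: abs_le_square_iff)
      then show ?thesis by auto
    qed
    then have "?x \<in> S' u" using sq od by (auto simp: S'_def S_def)
    moreover have "A \<in> Bad u ?x"
      unfolding Bad_def using A(1) dv by (auto simp: PiE_iff)
    ultimately show False using A(2) u by auto
  qed
qed

text \<open>The oddness condition disappears by dividing a short vector by the largest power of 2
  common to its \<open>J\<close> coordinates, which only lowers the level from \<open>j\<close> to
  \<open>u = j - i\<close>.\<close>

lemma exists_long_congruence_lattice:
  fixes I J :: "'a set" and j :: nat
  assumes fin: "finite I" "finite J"
    and size: "card (I \<union> J) \<le> 4 ^ Suc j" and k: "11 * 4 ^ j \<le> card I * j"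
  shows "\<exists>A. \<forall>x. (\<exists>r\<in>I \<union> J. x r \<noteq> 0) \<longrightarrow>
      (\<forall>i\<in>I. int (2 ^ j) dvd x i - (\<Sum>l\<in>J. A i l * x l)) \<longrightarrow>
      (\<Sum>i\<in>I \<union> J. (x i)\<^sup>2) \<ge> (int (2 ^ j))\<^sup>2"
proof -
  have "card {x \<in> PiE (I \<union> J) (\<lambda>_. {- int (2 ^ u)..int (2 ^ u)}). (\<Sum>i\<in>I \<union> J. (x i)\<^sup>2) \<le> int (4 ^ u)} * 2 ^ u
        \<le> 2 ^ (u * card I)" (is "card ?S * _ \<le> _") if "1 \<le> u" "u \<le> j" for u
  proof -
    define t where "t = j - u"
    have j: "j = u + t" using that by (simp add: t_def)
    have "card ?S * 2 ^ u \<le> 2 ^ (2 * (t + 5) * 4 ^ u) * 2 ^ u"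
      using fin size j by (intro mult_right_mono card_integer_points_le) auto
    also have "\<dots> = 2 ^ (2 * (t + 5) * 4 ^ u + u)" by (simp add: power_add)
    also have "\<dots> \<le> 2 ^ (u * card I)"
      using that k j by (intro power_increasing level_exponent_le) auto
    finally show ?thesis .
  qed
  from exists_avoiding_matrix[OF fin this] obtain A where
    A: "\<And>u x. 1 \<le> u \<Longrightarrow> u \<le> j \<Longrightarrow> (\<Sum>i\<in>I \<union> J. (x i)\<^sup>2) \<le> int (4 ^ u) \<Longrightarrow> \<exists>l\<in>J. odd (x l) \<Longrightarrow>
      \<not> (\<forall>i\<in>I. int (2 ^ u) dvd x i - (\<Sum>l\<in>J. A i l * x l))" by blast
  show ?thesis
  proof (intro exI[of _ A] allI impI, rule ccontr)
    fix x
    assume nz: "\<exists>r\<in>I \<union> J. x r \<noteq> 0"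
      and dv: "\<forall>i\<in>I. int (2 ^ j) dvd x i - (\<Sum>l\<in>J. A i l * x l)"
      and "\<not> (int (2 ^ j))\<^sup>2 \<le> (\<Sum>i\<in>I \<union> J. (x i)\<^sup>2)"
    then have short: "(\<Sum>i\<in>I \<union> J. (x i)\<^sup>2) < (int (2 ^ j))\<^sup>2" by simp
    have small: "\<bar>x r\<bar> < int (2 ^ j)" if "r \<in> I \<union> J" for r
    proof -
      have "(x r)\<^sup>2 \<le> (\<Sum>i\<in>I \<union> J. (x i)\<^sup>2)" using that fin by (intro member_le_sum) auto
      then have "(x r)\<^sup>2 < (int (2 ^ j))\<^sup>2" using short by linarith
      then have "\<bar>x r\<bar>\<^sup>2 < (int (2 ^ j))\<^sup>2" by simp
      then show ?thesis by (rule power_less_imp_less_base) simp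
    qed
    then have zero: "x r = 0" if "r \<in> I \<union> J" "int (2 ^ j) dvd x r" for r
      using that small[of r] dvd_imp_le_int[of "x r" "int (2 ^ j)"] by fastforce
    \<comment> \<open>Coordinates of a short vector lie strictly below \<open>2 ^ j\<close> in
      absolute value, so divisible ones vanish; if all of \<open>J\<close> vanished, the congruences
      would force \<open>I\<close> to vanish as well.\<close>
    have notj: "\<not> (\<forall>l\<in>J. int (2 ^ j) dvd x l)"
    proof
      assume "\<forall>l\<in>J. int (2 ^ j) dvd x l"
      then have J0: "\<forall>l\<in>J. x l = 0" using zero by auto
      then have "\<forall>i\<in>I. int (2 ^ j) dvd x i" using dv by simp
      then have "\<forall>i\<in>I. x i = 0" using zero by auto
      with J0 nz show False by auto
    qed
    obtain i where i: "\<forall>l\<in>J. int (2 ^ i) dvd x l" "\<not> (\<forall>l\<in>J. int (2 ^ Suc i) dvd x l)"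
    proof (rule ccontr)
      assume "\<not> thesis"
      then have step: "(\<forall>l\<in>J. int (2 ^ i) dvd x l) \<longrightarrow> (\<forall>l\<in>J. int (2 ^ Suc i) dvd x l)" for i
        using that by blast
      have "\<forall>l\<in>J. int (2 ^ i) dvd x l" for i
      proof (induction i)
        case (Suc i)
        then show ?case using step by blast
      qed simp
      with notj show False by blast
    qed
    have ij: "i < j"
    proof (rule ccontr)
      assume "\<not> i < j"
      then have "int (2 ^ j) dvd int (2 ^ i)" by (simp add: le_imp_power_dvd)
      with i(1) notj show False using dvd_trans by blast
    qed
    define u where "u = j - i"
    have u: "1 \<le> u" "u \<le> j" "j = i + u" using ij by (auto simp: u_def)
    have pw: "int (2 ^ j) = int (2 ^ i) * int (2 ^ u)" by (simp add: u(3) power_add)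
    \<comment> \<open>The congruences carry the common divisor from \<open>J\<close> over to
      \<open>I\<close>, so the whole vector can be divided.\<close>
    have dvI: "int (2 ^ i) dvd x r" if "r \<in> I \<union> J" for r
    proof (cases "r \<in> J")
      case False
      have "int (2 ^ i) dvd x r - (\<Sum>l\<in>J. A r l * x l)"
        using dv that False unfolding pw by (auto intro: dvd_mult_left)
      moreover have "int (2 ^ i) dvd (\<Sum>l\<in>J. A r l * x l)" using i(1) by (intro dvd_sum) auto
      ultimately have "int (2 ^ i) dvd (x r - (\<Sum>l\<in>J. A r l * x l)) + (\<Sum>l\<in>J. A r l * x l)"
        by (rule dvd_add)
      then show ?thesis by (simp only: diff_add_cancel)
    qed (use i in auto)
    define y where "y r = x r div int (2 ^ i)" for r
    have xy: "x r = int (2 ^ i) * y r" if "r \<in> I \<union> J" for r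
      using dvI[OF that] by (simp add: y_def)
    have "(int (2 ^ i))\<^sup>2 * (\<Sum>r\<in>I \<union> J. (y r)\<^sup>2) = (\<Sum>r\<in>I \<union> J. (x r)\<^sup>2)"
      by (simp add: sum_distrib_left xy power_mult_distrib)
    also have "\<dots> \<le> (int (2 ^ i))\<^sup>2 * (int (2 ^ u))\<^sup>2" using short unfolding pw power_mult_distrib by simp
    finally have "(\<Sum>r\<in>I \<union> J. (y r)\<^sup>2) \<le> (int (2 ^ u))\<^sup>2" by simp
    also have "\<dots> = int (4 ^ u)" by (simp add: power2_eq_square power_mult_distrib[symmetric])
    finally have s: "(\<Sum>r\<in>I \<union> J. (y r)\<^sup>2) \<le> int (4 ^ u)" .
    have o: "\<exists>l\<in>J. odd (y l)"
    proof -
      obtain l where l: "l \<in> J" "\<not> int (2 ^ Suc i) dvd x l" using i(2) by blast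
      then have "\<not> int (2 ^ i) * 2 dvd int (2 ^ i) * y l" using xy[of l] by (simp add: mult.commute)
      then have "odd (y l)" by simp
      with l(1) show ?thesis by blast
    qed
    have "int (2 ^ u) dvd y r - (\<Sum>l\<in>J. A r l * y l)" if "r \<in> I" for r
    proof -
      have "(\<Sum>l\<in>J. A r l * x l) = int (2 ^ i) * (\<Sum>l\<in>J. A r l * y l)"
        using xy by (simp add: sum_distrib_left algebra_simps)
      then have "x r - (\<Sum>l\<in>J. A r l * x l) = int (2 ^ i) * (y r - (\<Sum>l\<in>J. A r l * y l))"
        using xy[of r] that by (simp add: algebra_simps)
      then have "int (2 ^ i) * int (2 ^ u) dvd int (2 ^ i) * (y r - (\<Sum>l\<in>J. A r l * y l))"
        using dv[rule_format, OF that] unfolding pw by simp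
      then show ?thesis by simp
    qed
    with A[OF u(1,2) s o] show False by blast
  qed
qed

subsection \<open>Lattices given by congruences\<close>

text \<open>Up to the scale \<open>s\<close>, the block matrix with rows (q I, A) and (0, I), whose
  columns generate a q-ary lattice in systematic form. Being triangular, it shows its determinant on
  the diagonal.\<close>

definition congruence_basis :: "real \<Rightarrow> nat \<Rightarrow> nat \<Rightarrow> nat \<Rightarrow> (nat \<Rightarrow> nat \<Rightarrow> int) \<Rightarrow> real mat" where
  "congruence_basis s q K d A = mat d d (\<lambda>(i, l). s *
     (if i = l then (if i < K then real q else 1)
      else if i < K \<and> K \<le> l then real_of_int (A i l) else 0))"

lemma congruence_basis_carrier [simp]: "congruence_basis s q K d A \<in> carrier_mat d d"
  by (simp add: congruence_basis_def)

lemma dim_col_congruence_basis [simp]: "dim_col (congruence_basis s q K d A) = d"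
  by (simp add: congruence_basis_def)

lemma det_congruence_basis:
  assumes "K \<le> d"
  shows "det (congruence_basis s q K d A) = s ^ d * real q ^ K"
proof -
  let ?B = "congruence_basis s q K d A"
  have "upper_triangular ?B" by (auto simp: congruence_basis_def)
  then have "det ?B = (\<Prod>i = 0..<d. ?B $$ (i, i))"
    by (subst det_upper_triangular[of _ d]) (auto simp: prod_list_diag_prod congruence_basis_def)
  also have "\<dots> = (\<Prod>i = 0..<d. s) * (\<Prod>i = 0..<d. if i < K then real q else 1)"
    by (simp add: congruence_basis_def prod.distrib del: prod_constant)
  also have "(\<Prod>i = 0..<d. if i < K then real q else 1) = (\<Prod>i\<in>{0..<K}. real q)"
    using assms by (intro prod.mono_neutral_cong_right) auto
  finally show ?thesis by simp
qed

lemma congruence_basis_mult_vec: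
  assumes "K \<le> d" "i < d" and z: "z \<in> carrier_vec d"
  shows "(congruence_basis s q K d A *\<^sub>v map_vec real_of_int z) $ i =
    s * of_int (if i < K then int q * z $ i + (\<Sum>l = K..<d. A i l * z $ l) else z $ i)"
proof -
  let ?e = "\<lambda>l. s * (if i = l then (if i < K then real q else 1)
      else if i < K \<and> K \<le> l then real_of_int (A i l) else 0) * of_int (z $ l)"
  have "(congruence_basis s q K d A *\<^sub>v map_vec real_of_int z) $ i = (\<Sum>l = 0..<d. ?e l)"
    using assms by (simp add: congruence_basis_def scalar_prod_def)
  also have "\<dots> = s * of_int (if i < K then int q * z $ i + (\<Sum>l = K..<d. A i l * z $ l) else z $ i)"
  proof (cases "i < K")
    case True
    have "(\<Sum>l = 0..<d. ?e l) = (\<Sum>l = 0..<K. ?e l) + (\<Sum>l = K..<d. ?e l)"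
      using assms by (simp add: sum.atLeastLessThan_concat)
    also have "(\<Sum>l = 0..<K. ?e l) = (\<Sum>l = 0..<K. if l = i then s * real q * z $ i else 0)"
      using True by (intro sum.cong) auto
    also have "\<dots> = s * real q * z $ i" using True by simp
    also have "(\<Sum>l = K..<d. ?e l) = (\<Sum>l = K..<d. s * (A i l * z $ l))"
      using True by (intro sum.cong) auto
    finally show ?thesis using True by (simp add: sum_distrib_left algebra_simps)
  next
    case False
    have "(\<Sum>l = 0..<d. ?e l) = (\<Sum>l = 0..<d. if l = i then s * z $ i else 0)"
      using False by (intro sum.cong) auto
    then show ?thesis using False assms by simp
  qed
  finally show ?thesis .
qed

text \<open>The coordinates from \<open>K\<close> on are free parameters and equal their own
  coefficients; each of the first \<open>K\<close> coefficients is the quotient by \<open>q\<close>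
  in the corresponding congruence.\<close>

lemma lattice_of_congruence_basis:
  assumes "K \<le> d" "q > 0"
  shows "lattice_of (congruence_basis s q K d A) =
    {vec d (\<lambda>i. s * of_int (x i)) | x. \<forall>i<K. int q dvd x i - (\<Sum>l = K..<d. A i l * x l)}"
    (is "?L = ?R")
proof (intro Set.set_eqI iffI)
  fix v assume "v \<in> ?L"
  then obtain z where z: "z \<in> carrier_vec d"
    and v: "v = congruence_basis s q K d A *\<^sub>v map_vec real_of_int z"
    by (auto simp: lattice_of_def)
  let ?x = "\<lambda>i. if i < K then int q * z $ i + (\<Sum>l = K..<d. A i l * z $ l) else z $ i"
  have "v = vec d (\<lambda>i. s * of_int (?x i))"
    using z assms congruence_basis_mult_vec[OF assms(1) _ z, of _ s q A]
    by (intro eq_vecI) (auto simp: v congruence_basis_def)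
  moreover have "\<forall>i<K. int q dvd ?x i - (\<Sum>l = K..<d. A i l * ?x l)" by simp
  ultimately show "v \<in> ?R" by (intro CollectI exI[of _ ?x] conjI)
next
  fix v assume "v \<in> ?R"
  then obtain x where v: "v = vec d (\<lambda>i. s * of_int (x i))"
    and x: "\<forall>i<K. int q dvd x i - (\<Sum>l = K..<d. A i l * x l)" by blast
  define z where "z = vec d (\<lambda>i. if i < K then (x i - (\<Sum>l = K..<d. A i l * x l)) div int q else x i)"
  have z: "z \<in> carrier_vec d" by (simp add: z_def)
  have "v = congruence_basis s q K d A *\<^sub>v map_vec real_of_int z"
  proof (rule eq_vecI)
    fix i assume "i < dim_vec (congruence_basis s q K d A *\<^sub>v map_vec real_of_int z)"
    then have i: "i < d" by (simp add: congruence_basis_def)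
    have zx: "(\<Sum>l = K..<d. A i l * z $ l) = (\<Sum>l = K..<d. A i l * x l)"
      by (intro sum.cong) (auto simp: z_def)
    have "int q * z $ i = x i - (\<Sum>l = K..<d. A i l * x l)" if "i < K"
      using x that i by (simp add: z_def)
    then have "(if i < K then int q * z $ i + (\<Sum>l = K..<d. A i l * z $ l) else z $ i) = x i"
      using i zx by (auto simp: z_def)
    then show "v $ i = (congruence_basis s q K d A *\<^sub>v map_vec real_of_int z) $ i"
      using i assms by (simp only: congruence_basis_mult_vec[OF assms(1) i z]) (simp add: v)
  qed (simp add: v congruence_basis_def)
  then show "v \<in> ?L" using z by (auto simp: lattice_of_def)
qed

section \<open>From a lattice without short vectors to a bound on \<open>N\<close>\<close>

lemma vnorm_vec: "vnorm (vec d f) = sqrt (\<Sum>i<d. (f i)\<^sup>2)"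
  by (simp add: vnorm_def scalar_prod_def power2_eq_square lessThan_atLeast0)

text \<open>The scale \<open>s\<close> makes the determinant 1. By \<open>long\<close>, the vectors
  of length \<open>s * q\<close> along the axes are shortest, and they span. The zero rows of
  \<open>A\<close> make the first \<open>n\<close> coordinates multiples of \<open>s * q\<close>, so
  the point with halves there is far from the lattice.\<close>

lemma N_lower_bound:
  fixes q K n d :: nat and A :: "nat \<Rightarrow> nat \<Rightarrow> int"
  assumes q: "q > 0" and nK: "n \<le> K" and Kd: "K \<le> d" and d: "d > 0"
    and A0: "\<And>i l. i < n \<Longrightarrow> A i l = 0"
    and long: "\<And>x. \<exists>i<d. x i \<noteq> 0 \<Longrightarrow> \<forall>i<K. int q dvd x i - (\<Sum>l = K..<d. A i l * x l) \<Longrightarrow>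
      (int q)\<^sup>2 \<le> (\<Sum>i<d. (x i)\<^sup>2)"
  shows "ereal (root d (1 / real q ^ K) * real q * sqrt (real n) / 2) \<le> N d"
proof -
  define s where "s = root d (1 / real q ^ K)"
  have s: "s > 0" using q d by (simp add: s_def)
  have sd: "s ^ d = 1 / real q ^ K" using q d by (simp add: s_def)
  let ?B = "congruence_basis s q K d A"
  let ?L = "lattice_of ?B"
  define C where "C x \<longleftrightarrow> (\<forall>i<K. int q dvd x i - (\<Sum>l = K..<d. A i l * x l))" for x
  have L: "?L = {vec d (\<lambda>i. s * of_int (x i)) | x. C x}"
    unfolding C_def by (rule lattice_of_congruence_basis[OF Kd q])
  have det: "det ?B = 1" using q by (simp add: det_congruence_basis[OF Kd] sd)
  have lat: "is_lattice d ?L" and uni: "unimodular d ?L"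
    unfolding is_lattice_def unimodular_def using det
    by (auto intro!: bexI[of _ ?B])
  have C_mult: "C (\<lambda>i. int q * y i)" for y
    unfolding C_def by (auto intro!: dvd_diff dvd_sum)
  have mem: "vec d (\<lambda>i. s * of_int (int q * y i)) \<in> ?L" for y
    unfolding L by (intro CollectI exI[of _ "\<lambda>i. int q * y i"] conjI refl C_mult)
  have nrm: "vnorm (vec d (\<lambda>i. s * real_of_int (x i))) = s * sqrt (\<Sum>i<d. of_int ((x i)\<^sup>2))" for x
    using s by (simp add: vnorm_vec power_mult_distrib sum_distrib_left[symmetric] real_sqrt_mult)
  define e where "e r = vec d (\<lambda>i. s * real_of_int (int q * (if i = r then 1 else 0)))" for r
  have e_sv: "e r \<in> shortest_vectors ?L" if r: "r < d" for r
  proof -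
    have eL: "e r \<in> ?L" unfolding e_def by (rule mem)
    have "(\<Sum>i<d. real_of_int ((int q * (if i = r then 1 else 0))\<^sup>2)) = (\<Sum>i<d. if i = r then (real q)\<^sup>2 else 0)"
      by (intro sum.cong) auto
    then have en: "vnorm (e r) = s * q" unfolding e_def nrm using r by simp
    have "e r $ r \<noteq> 0\<^sub>v (dim_vec (e r)) $ r" using r s q by (simp add: e_def)
    then have nz: "e r \<noteq> 0\<^sub>v (dim_vec (e r))" by metis
    have "s * q \<le> vnorm w" if w: "w \<in> ?L" "w \<noteq> 0\<^sub>v (dim_vec w)" for w
    proof -
      obtain x where x: "C x" "w = vec d (\<lambda>i. s * of_int (x i))" using w(1) L by auto
      have "\<exists>i<d. x i \<noteq> 0"
      proof (rule ccontr)
        assume "\<not> (\<exists>i<d. x i \<noteq> 0)"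
        then have "w = 0\<^sub>v (dim_vec w)" unfolding x(2) by (intro eq_vecI) auto
        with w(2) show False ..
      qed
      then have "(int q)\<^sup>2 \<le> (\<Sum>i<d. (x i)\<^sup>2)" using long x(1) unfolding C_def by blast
      then have "real_of_int ((int q)\<^sup>2) \<le> real_of_int (\<Sum>i<d. (x i)\<^sup>2)" by (simp only: of_int_le_iff)
      then have "real q \<le> sqrt (\<Sum>i<d. of_int ((x i)\<^sup>2))"
        by (intro real_le_rsqrt) simp
      then show ?thesis unfolding x(2) nrm using s by simp
    qed
    then show ?thesis unfolding shortest_vectors_def using eL nz by (simp add: en)
  qed
  have wr: "well_rounded d ?L"
    unfolding well_rounded_def spans_def
  proof
    fix x :: "real vec" assume x: "x \<in> carrier_vec d"
    let ?vs = "map e [0..<d]" and ?c = "(1 / (s * q)) \<cdot>\<^sub>v x"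
    have "mat_of_cols d ?vs *\<^sub>v ?c = x"
    proof (rule eq_vecI)
      fix i assume "i < dim_vec x"
      then have i: "i < d" using x by simp
      have "(mat_of_cols d ?vs *\<^sub>v ?c) $ i = (\<Sum>l = 0..<d. e l $ i * (1 / (s * q) * x $ l))"
        using i x by (simp add: scalar_prod_def mat_of_cols_index)
      also have "\<dots> = (\<Sum>l = 0..<d. if l = i then x $ i else 0)"
        using i s q by (intro sum.cong) (auto simp: e_def)
      finally show "(mat_of_cols d ?vs *\<^sub>v ?c) $ i = x $ i" using i by simp
    qed (use x in auto)
    then show "\<exists>vs c. set vs \<subseteq> shortest_vectors ?L \<and> c \<in> carrier_vec (length vs) \<and> x = mat_of_cols d vs *\<^sub>v c"
      using x e_sv by (intro exI[of _ ?vs] exI[of _ ?c]) auto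
  qed
  have "s * q * sqrt n / 2 \<le> covering_radius d ?L"
    unfolding covering_radius_def
  proof (rule cInf_greatest)
    let ?r = "s * q * sqrt d"
    \<comment> \<open>Bounding \<open>Inf\<close> from below requires some admissible radius to
      exist: rounding every coordinate down to a multiple of \<open>s * q\<close> provides
      one.\<close>
    have "\<exists>v\<in>?L. vnorm (x - v) \<le> ?r" if x: "x \<in> carrier_vec d" for x
    proof
      let ?v = "vec d (\<lambda>i. s * real_of_int (int q * \<lfloor>x $ i / (s * q)\<rfloor>))"
      show "?v \<in> ?L" by (rule mem)
      have "x - ?v = vec d (\<lambda>i. (s * q) * (x $ i / (s * q) - \<lfloor>x $ i / (s * q)\<rfloor>))"
        using x s q by (intro eq_vecI) (auto simp: field_simps)
      then have "vnorm (x - ?v) = sqrt (\<Sum>i<d. ((s * q) * (x $ i / (s * q) - \<lfloor>x $ i / (s * q)\<rfloor>))\<^sup>2)"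
        by (simp only: vnorm_vec)
      also have "\<dots> \<le> sqrt (\<Sum>i<d. (s * q)\<^sup>2)"
      proof (intro real_sqrt_le_mono sum_mono power_mono)
        fix i
        have "x $ i / (s * q) - \<lfloor>x $ i / (s * q)\<rfloor> \<le> 1" by linarith
        then show "(s * q) * (x $ i / (s * q) - \<lfloor>x $ i / (s * q)\<rfloor>) \<le> s * q"
          using s q by (intro mult_left_le) auto
      qed (use s q in auto)
      also have "\<dots> = ?r" using s q by (simp add: real_sqrt_mult)
      finally show "vnorm (x - ?v) \<le> ?r" .
    qed
    moreover have "0 \<le> ?r" using s by simp
    ultimately show "{r. r \<ge> 0 \<and> (\<forall>x \<in> carrier_vec d. \<exists>v \<in> ?L. vnorm (x - v) \<le> r)} \<noteq> {}" by blast
  next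
    fix r assume "r \<in> {r. r \<ge> 0 \<and> (\<forall>x \<in> carrier_vec d. \<exists>v \<in> ?L. vnorm (x - v) \<le> r)}"
    then have r: "\<forall>x \<in> carrier_vec d. \<exists>v \<in> ?L. vnorm (x - v) \<le> r" by blast
    define h where "h = vec d (\<lambda>i. if i < n then s * q / 2 else 0)"
    have "h \<in> carrier_vec d" by (simp add: h_def)
    then obtain x where x: "C x" "vnorm (h - vec d (\<lambda>i. s * real_of_int (x i))) \<le> r"
      using r unfolding L by blast
    have "s * q * sqrt n / 2 = sqrt (\<Sum>i<n. (s * q / 2)\<^sup>2)"
      using s q by (simp add: real_sqrt_mult real_sqrt_divide)
    also have "\<dots> \<le> sqrt (\<Sum>i<d. ((if i < n then s * q / 2 else 0) - s * real_of_int (x i))\<^sup>2)"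
    proof (rule real_sqrt_le_mono)
      have "(\<Sum>i<n. (s * q / 2)\<^sup>2) \<le> (\<Sum>i<n. ((if i < n then s * q / 2 else 0) - s * real_of_int (x i))\<^sup>2)"
      proof (rule sum_mono)
        fix i assume "i \<in> {..<n}"
        then have i: "i < n" by simp
        then have "int q dvd x i" using x(1)[unfolded C_def, rule_format, of i] nK A0[OF i] by simp
        then obtain y where y: "x i = int q * y" by blast
        \<comment> \<open>The distance in this coordinate is \<open>s * q / 2\<close> times the
          absolute value of an odd integer.\<close>
        have "1 \<le> \<bar>1 - 2 * y\<bar>" by presburger
        then have "(1::real) \<le> \<bar>1 - 2 * real_of_int y\<bar>" by linarith
        then have "s * q / 2 * 1 \<le> s * q / 2 * \<bar>1 - 2 * real_of_int y\<bar>"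
          using s by (intro mult_left_mono) auto
        also have "\<dots> = \<bar>s * q / 2 * (1 - 2 * real_of_int y)\<bar>" using s by (simp add: abs_mult)
        also have "s * q / 2 * (1 - 2 * real_of_int y) = s * q / 2 - s * real_of_int (x i)"
          by (simp add: y field_simps)
        finally have "\<bar>s * q / 2\<bar> \<le> \<bar>s * q / 2 - s * real_of_int (x i)\<bar>" using s by simp
        then show "(s * q / 2)\<^sup>2 \<le> ((if i < n then s * q / 2 else 0) - s * real_of_int (x i))\<^sup>2"
          using i by (simp only: abs_le_square_iff if_True)
      qed
      also have "\<dots> \<le> (\<Sum>i<d. ((if i < n then s * q / 2 else 0) - s * real_of_int (x i))\<^sup>2)"
        using nK Kd by (intro sum_mono2) auto
      finally show "(\<Sum>i<n. (s * q / 2)\<^sup>2) \<le> (\<Sum>i<d. ((if i < n then s * q / 2 else 0) - s * real_of_int (x i))\<^sup>2)" .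
    qed
    also have "\<dots> = vnorm (h - vec d (\<lambda>i. s * real_of_int (x i)))"
      unfolding vnorm_vec[symmetric] by (intro arg_cong[of _ _ vnorm] eq_vecI) (auto simp: h_def)
    also note x(2)
    finally show "s * q * sqrt n / 2 \<le> r" .
  qed
  moreover have "ereal (covering_radius d ?L) \<le> N d"
    unfolding N_def using lat wr uni by (intro SUP_upper) auto
  ultimately show ?thesis unfolding s_def[symmetric] by (meson ereal_less_eq(3) order_trans)
qed

subsection \<open>The lower bound\<close>

text \<open>The integer lattice, obtained with \<open>q = 1\<close>; it settles the dimensions too
  small for the random construction.\<close>

lemma N_ge_half_sqrt:
  assumes "d > 0"
  shows "ereal (sqrt (real d) / 2) \<le> N d"
proof -
  have "(int 1)\<^sup>2 \<le> (\<Sum>i<d. (x i)\<^sup>2)" if nz: "\<exists>i<d. x i \<noteq> 0" for x :: "nat \<Rightarrow> int"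
  proof -
    obtain i where i: "i < d" "x i \<noteq> 0" using nz by blast
    have "1 \<le> (x i)\<^sup>2" using i(2) by (simp add: int_one_le_iff_zero_less)
    also have "\<dots> \<le> (\<Sum>i<d. (x i)\<^sup>2)" using i by (intro member_le_sum) auto
    finally show ?thesis by simp
  qed
  from N_lower_bound[of 1 d d d "\<lambda>_ _. 0", OF _ _ _ _ _ this] assms show ?thesis by simp
qed

text \<open>Here \<open>q = 2 ^ j\<close> is within a factor 2 of the square root of
  \<open>d\<close>, and the lattice is an orthogonal sum of q times the integers in \<open>k\<close>
  coordinates and a random congruence lattice in the other \<open>d - k\<close>.\<close>

lemma N_ge_large:
  assumes j: "32 \<le> j" and d: "4 ^ j \<le> d" "d < 4 ^ Suc j"
  shows "ereal (1 / 2 ^ 26 * (real d / sqrt (ln (real d)))) \<le> N d"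
proof -
  \<comment> \<open>Essentially the least \<open>k\<close> that the union bound permits. Adding 1
    repairs the rounding and raises \<open>k * j\<close> to at most
    \<open>12 * 4 ^ j\<close>.\<close>
  define k where "k = 11 * 4 ^ j div j + 1"
  have k_lo: "11 * 4 ^ j \<le> k * j"
  proof -
    have "k * j = 11 * 4 ^ j div j * j + j" by (simp add: k_def)
    moreover have "11 * 4 ^ j = 11 * 4 ^ j div j * j + 11 * 4 ^ j mod j" by (rule div_mult_mod_eq[symmetric])
    moreover have "11 * 4 ^ j mod j < j" using j by simp
    ultimately show ?thesis by linarith
  qed
  have k_hi: "k * j \<le> 12 * 4 ^ j"
  proof -
    have "j \<le> 4 ^ j" by (intro less_imp_le power_gt_expt) simp
    moreover have "k * j = 11 * 4 ^ j div j * j + j" by (simp add: k_def)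
    moreover have "11 * 4 ^ j div j * j \<le> 11 * 4 ^ j" by (rule div_times_less_eq_dividend)
    ultimately show ?thesis by linarith
  qed
  \<comment> \<open>Both blocks of \<open>k\<close> coordinates fit because \<open>j\<close> is at
    least 24.\<close>
  have "(2 * k) * j \<le> 24 * d" using k_hi d by linarith
  also have "\<dots> \<le> d * j" using j by simp
  finally have kd: "2 * k \<le> d" using j by simp
  have un: "{k..<2 * k} \<union> {2 * k..<d} = {k..<d}" using kd by auto
  have "card ({k..<2 * k} \<union> {2 * k..<d}) \<le> 4 ^ Suc j" unfolding un using d by simp
  moreover have "11 * 4 ^ j \<le> card {k..<2 * k} * j" using k_lo by simp
  ultimately obtain A where A: "\<And>x. \<exists>r\<in>{k..<d}. x r \<noteq> 0 \<Longrightarrow>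
      \<forall>i\<in>{k..<2 * k}. int (2 ^ j) dvd x i - (\<Sum>l\<in>{2 * k..<d}. A i l * x l) \<Longrightarrow>
      (int (2 ^ j))\<^sup>2 \<le> (\<Sum>i\<in>{k..<d}. (x i)\<^sup>2)"
    using exists_long_congruence_lattice[of "{k..<2 * k}" "{2 * k..<d}" j] unfolding un by auto
  define A' where "A' i l = (if i < k then 0 else A i l)" for i l
  have "(int (2 ^ j))\<^sup>2 \<le> (\<Sum>i<d. (x i)\<^sup>2)"
    if nz: "\<exists>i<d. x i \<noteq> 0" and C: "\<forall>i<2 * k. int (2 ^ j) dvd x i - (\<Sum>l = 2 * k..<d. A' i l * x l)" for x
  proof (cases "\<exists>i<k. x i \<noteq> 0")
    case True
    then obtain i where i: "i < k" "x i \<noteq> 0" by blast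
    then have "int (2 ^ j) dvd x i" using C[rule_format, of i] by (simp add: A'_def)
    then have "\<bar>int (2 ^ j)\<bar> \<le> \<bar>x i\<bar>" using i(2) by (rule dvd_imp_le_int[rotated])
    then have "(int (2 ^ j))\<^sup>2 \<le> (x i)\<^sup>2" by (simp only: abs_le_square_iff)
    also have "\<dots> \<le> (\<Sum>i<d. (x i)\<^sup>2)" using i kd by (intro member_le_sum) auto
    finally show ?thesis .
  next
    case False
    then have "\<exists>r\<in>{k..<d}. x r \<noteq> 0" using nz by (metis atLeastLessThan_iff linorder_not_less)
    moreover have "\<forall>i\<in>{k..<2 * k}. int (2 ^ j) dvd x i - (\<Sum>l\<in>{2 * k..<d}. A i l * x l)"
    proof
      fix i assume "i \<in> {k..<2 * k}"
      then show "int (2 ^ j) dvd x i - (\<Sum>l\<in>{2 * k..<d}. A i l * x l)"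
        using C[rule_format, of i] by (simp add: A'_def)
    qed
    ultimately have "(int (2 ^ j))\<^sup>2 \<le> (\<Sum>i\<in>{k..<d}. (x i)\<^sup>2)" by (rule A)
    also have "\<dots> \<le> (\<Sum>i<d. (x i)\<^sup>2)" by (intro sum_mono2) auto
    finally show ?thesis .
  qed
  moreover have "d > 0" using d(1) by (metis gr0I le_zero_eq power_not_zero zero_neq_numeral)
  ultimately have N: "ereal (root d (1 / real (2 ^ j) ^ (2 * k)) * real (2 ^ j) * sqrt (real k) / 2) \<le> N d"
    using kd by (intro N_lower_bound[where A = A']) (auto simp: A'_def)
  \<comment> \<open>Since \<open>k * j \<le> 12 * d\<close>, the determinant
    \<open>2 ^ (j * (2 * k))\<close> is at most \<open>2 ^ (24 * d)\<close>; its d-th root costs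
    only a constant.\<close>
  have "1 / 2 ^ 24 = root d ((1 / 2 ^ 24) ^ d)" using \<open>d > 0\<close> by (simp add: real_root_power_cancel)
  also have "\<dots> \<le> root d (1 / real (2 ^ j) ^ (2 * k))"
  proof -
    have "j * (2 * k) \<le> 24 * d" using k_hi d by (simp add: mult.commute[of j])
    then have "(2::real) ^ (j * (2 * k)) \<le> 2 ^ (24 * d)" by (intro power_increasing) auto
    then have "1 / (2::real) ^ (24 * d) \<le> 1 / 2 ^ (j * (2 * k))" by (intro divide_left_mono) auto
    moreover have "(1 / 2 ^ 24) ^ d = 1 / (2::real) ^ (24 * d)" by (simp only: power_mult power_one_over)
    moreover have "1 / real (2 ^ j) ^ (2 * k) = 1 / 2 ^ (j * (2 * k))"
      by (simp only: power_mult of_nat_power of_nat_numeral)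
    ultimately show ?thesis using \<open>d > 0\<close> by (simp only: real_root_le_iff)
  qed
  finally have s: "1 / 2 ^ 24 \<le> root d (1 / real (2 ^ j) ^ (2 * k))" .
  have jl: "real j \<le> ln (real d)"
  proof -
    have "exp (real j) = exp 1 ^ j" by (simp add: exp_of_nat_mult[symmetric])
    also have "\<dots> \<le> 4 ^ j" using exp_le by (intro power_mono) auto
    also have "\<dots> \<le> real d" using d(1) by (metis of_nat_le_iff of_nat_numeral of_nat_power)
    finally show ?thesis using \<open>d > 0\<close> by (simp add: ln_ge_iff)
  qed
  have lpos: "ln (real d) > 0" using jl j by linarith
  \<comment> \<open>Squared, this combines \<open>d \<le> 4 * 4 ^ j\<close>,
    \<open>11 * 4 ^ j \<le> k * j\<close> and \<open>j \<le> ln d\<close>; numerically it needs 16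
    to be at most 44.\<close>
  have "real d / 2 / sqrt (ln (real d)) \<le> real (2 ^ j) * sqrt (real k)"
  proof -
    have "real d \<le> 4 * 4 ^ j" using d(2) by (metis less_imp_le of_nat_le_iff of_nat_numeral of_nat_power power_Suc)
    then have "(real d)\<^sup>2 \<le> (4 * 4 ^ j)\<^sup>2" by (intro power_mono) auto
    also have "\<dots> = 16 * 4 ^ j * 4 ^ j" by (simp add: power2_eq_square)
    also have "\<dots> \<le> 4 * 4 ^ j * (11 * 4 ^ j)" by simp
    also have "\<dots> \<le> 4 * 4 ^ j * (real k * real j)"
    proof (rule mult_left_mono)
      have "real (11 * 4 ^ j) \<le> real (k * j)" using k_lo by (simp only: of_nat_le_iff)
      then show "11 * 4 ^ j \<le> real k * real j" by simp
    qed simp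
    also have "\<dots> \<le> 4 * 4 ^ j * (real k * ln (real d))" using jl by (intro mult_left_mono) auto
    finally have "(real d / 2)\<^sup>2 / ln (real d) \<le> 4 ^ j * real k"
      using lpos by (simp add: field_simps power2_eq_square)
    then have "sqrt ((real d / 2)\<^sup>2 / ln (real d)) \<le> sqrt (4 ^ j * real k)" by (rule real_sqrt_le_mono)
    moreover have "sqrt ((4::real) ^ j) = 2 ^ j" by (simp add: real_sqrt_power)
    ultimately show ?thesis by (simp add: real_sqrt_divide real_sqrt_mult)
  qed
  then have "1 / 2 ^ 24 * (real d / 2 / sqrt (ln (real d)))
      \<le> root d (1 / real (2 ^ j) ^ (2 * k)) * (real (2 ^ j) * sqrt (real k))"
    using s lpos by (intro mult_mono order_trans[OF _ s]) auto
  \<comment> \<open>The exponent 26 collects 24 from the scaling, one factor 2 from the preceding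
    estimate and one from the halved coordinates.\<close>
  then have "1 / 2 ^ 26 * (real d / sqrt (ln (real d)))
      \<le> root d (1 / real (2 ^ j) ^ (2 * k)) * real (2 ^ j) * sqrt (real k) / 2"
    by (simp add: mult.assoc)
  with N show ?thesis by (meson ereal_less_eq(3) order_trans)
qed

theorem mainTheorem1:
  shows "\<exists>c::real. c > 0 \<and> (\<forall>d::nat. d > 3 \<longrightarrow>
           N d > ereal (c * real d / sqrt (ln (real d))))"
\<comment> \<open>The constant lies below \<open>1 / 2 ^ 64\<close>, so for
  \<open>d < 4 ^ 32\<close> the claimed bound is less than 1, and below \<open>1 / 2 ^ 26\<close>,
  which makes the inequality strict for larger \<open>d\<close>.\<close>
proof (intro exI[of _ "1 / 2 ^ 80"] conjI allI impI)
  fix d :: nat assume d: "d > 3"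
  have "exp 1 \<le> real d" using exp_le d by linarith
  then have ln1: "1 \<le> ln (real d)" using d by (simp add: ln_ge_iff)
  then have pos: "0 < real d / sqrt (ln (real d))" using d by (intro divide_pos_pos) auto
  show "N d > ereal (1 / 2 ^ 80 * real d / sqrt (ln (real d)))"
  proof (cases "d < 4 ^ 32")
    case True
    have "1 / 2 ^ 80 * real d / sqrt (ln (real d)) \<le> 1 / 2 ^ 80 * real d"
      using ln1 mult_left_mono[of 1 "sqrt (ln (real d))" "real d"] by (intro mult_imp_div_pos_le) auto
    also have "\<dots> < 1" using True by simp
    also have "1 \<le> sqrt (real d) / 2" using real_le_rsqrt[of 2 "real d"] d by simp
    finally have "ereal (1 / 2 ^ 80 * real d / sqrt (ln (real d))) < ereal (sqrt (real d) / 2)" by simp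
    also have "\<dots> \<le> N d" using d by (intro N_ge_half_sqrt) simp
    finally show ?thesis .
  next
    case False
    obtain j where j: "4 ^ j \<le> d" "d < 4 ^ Suc j" using ex_power_ivl1[of 4 d] d by auto
    have "4 ^ 32 < (4::nat) ^ Suc j" using False j by linarith
    then have "32 < Suc j" by (rule power_less_imp_less_exp[rotated]) simp
    then have "ereal (1 / 2 ^ 26 * (real d / sqrt (ln (real d)))) \<le> N d" using j by (intro N_ge_large) auto
    moreover have "1 / 2 ^ 80 * real d / sqrt (ln (real d)) < 1 / 2 ^ 26 * (real d / sqrt (ln (real d)))"
      using pos by simp
    ultimately show ?thesis by (meson less_ereal.simps(1) less_le_trans)
  qed
qed simp

end
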